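(* Let $h\in\omega^\omega$ go to infinity. Then $\mathfrak{b}^{\mathrm{LLc}}_{\omega,h}=\min\{\mathfrak{b},\mathrm{minLLc}_h\}$ and $\mathfrak{d}^{\mathrm{LLc}}_{\omega,h}=\max\{\mathfrak{d},\mathrm{supLLc}_h\}$. Equivalently, $\min\{\mathfrak{b},\mathfrak{e}\}=\min\{\mathfrak{b},\mathrm{minLLc}_h\}$ and $\max\{\mathfrak{d},\mathfrak{pr}\}=\max\{\mathfrak{d},\mathrm{supLLc}_h\}$.
   Context: For $b\in(\omega+1)^\omega$, $h\in\omega^\omega$ (convention $1\leq h(n)<b(n)$): $\prod b=\prod_n b(n)$, $\mathcal{S}(b,h)=\prod_n[b(n)]^{\leq h(n)}$; for $x\in\prod b$, $\varphi\in\mathcal{S}(b,h)$, $D\in[\omega]^\omega$, $x\in^*_D\varphi$ iff $x(n)\in\varphi(n)$ for all but finitely many $n\in D$. $\mathfrak{b}^{\mathrm{LLc}}_{b,h}$ is the least size of $F\subseteq\prod b$ such that no $(D,\varphi)\in[\omega]^\omega\times\mathcal{S}(b,h)$ has $x\in^*_D\varphi$ for all $x\in F$; $\mathfrak{d}^{\mathrm{LLc}}_{b,h}$ is the least size of $\Phi\subseteq[\omega]^\omega\times\mathcal{S}(b,h)$ such that every $x\in\prod b$ has $x\in^*_D\varphi$ for some $(D,\varphi)\in\Phi$. The subscript $\omega$ denotes the constant function with value $\omega$. $\mathrm{minLLc}_h=\min\{\mathfrak{b}^{\mathrm{LLc}}_{b,h}:b\in\omega^\omega\}$, $\mathrm{supLLc}_h=\sup\{\mathfrak{d}^{\mathrm{LLc}}_{b,h}:b\in\omega^\omega\}$.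 $\mathfrak{b},\mathfrak{d}$ are the unbounding and dominating numbers. A predictor is a pair $\pi=(D,\{\pi_n:n\in D\})$ with $D\in[\omega]^\omega$ and $\pi_n:\omega^n\to\omega$; $\pi$ predicts $f\in\omega^\omega$ if $f(n)=\pi_n(f\restriction n)$ for all but finitely many $n\in D$. $\mathfrak{e}$ is the least size of $F\subseteq\omega^\omega$ such that no single predictor predicts all members of $F$; $\mathfrak{pr}$ is the least size of a set of predictors such that every $f\in\omega^\omega$ is predicted by one of them. *)

theory Defs
  imports Complex_Main "HOL-Library.Extended_Nat" "HOL-Library.FuncSet" "HOL-Library.Nat_Bijection"
begin

unbundle cardinal_syntax

section \<open>Cardinals up to the continuum\<close>

text \<open>
  Equipotence classes of subsets of Baire space. All families whose sizes are considered below
  live in types of size at most continuum, so these are all the cardinals that can occur, and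
  being a wellorder the type supports \<open>LEAST\<close>, \<open>min\<close> and \<open>max\<close>.
\<close>

quotient_type ccard = "(nat \<Rightarrow> nat) set" / "\<lambda>A B. |A| =o |B|"
  by (rule equivpI)
    (auto intro!: reflpI sympI transpI intro: card_of_refl ordIso_symmetric ordIso_transitive)

instantiation ccard :: wellorder
begin

lift_definition less_eq_ccard :: "ccard \<Rightarrow> ccard \<Rightarrow> bool" is "\<lambda>A B. |A| \<le>o |B|"
  by (meson ordIso_ordLeq_trans ordIso_symmetric ordLeq_ordIso_trans)

lift_definition less_ccard :: "ccard \<Rightarrow> ccard \<Rightarrow> bool" is "\<lambda>A B. |A| <o |B|"
  by (meson ordIso_ordLess_trans ordIso_symmetric ordLess_ordIso_trans)

instance
proof
  fix x y z :: ccard and P :: "ccard \<Rightarrow> bool"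
  show "(x < y) = (x \<le> y \<and> \<not> y \<le> x)"
    by transfer (meson card_of_Well_order not_ordLess_iff_ordLeq ordLess_imp_ordLeq)
  show "x \<le> x"
    by transfer (simp add: ordLeq_reflexive card_of_Well_order)
  show "x \<le> y \<Longrightarrow> y \<le> z \<Longrightarrow> x \<le> z"
    by transfer (rule ordLeq_transitive)
  show "x \<le> y \<Longrightarrow> y \<le> x \<Longrightarrow> x = y"
    by transfer (simp add: ordIso_iff_ordLeq)
  show "x \<le> y \<or> y \<le> x"
    by transfer (simp add: ordLeq_total card_of_Well_order)
  show "P x" if step: "\<And>x. (\<And>y. y < x \<Longrightarrow> P y) \<Longrightarrow> P x"
  proof -
    have "P (abs_ccard A)" for A
    proof (induction A rule: wf_induct[OF wf_inv_image[OF wf_ordLess, of card_of]])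
      case (1 A)
      show ?case
      proof (rule step)
        fix y assume "y < abs_ccard A"
        moreover obtain B where "y = abs_ccard B"
          using Quotient3_abs_rep[OF Quotient3_ccard, of y] by metis
        ultimately show "P y"
          using 1 by (auto simp: less_ccard.abs_eq in_inv_image)
      qed
    qed
    then show ?thesis
      using Quotient3_abs_rep[OF Quotient3_ccard, of x] by metis
  qed
qed

end

definition csize :: "'a set \<Rightarrow> ccard" where
  "csize A = abs_ccard (SOME B. |B| =o |A| )"

lemma csize_rep:
  fixes A :: "'a set"
  assumes "|UNIV :: 'a set| \<le>o |UNIV :: (nat \<Rightarrow> nat) set|"
  shows "\<exists>B. csize A = abs_ccard B \<and> |B| =o |A|"
proof -
  have "|A| \<le>o |UNIV :: (nat \<Rightarrow> nat) set|"
    by (rule ordLeq_transitive[OF card_of_mono1[OF subset_UNIV] assms])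
  then obtain B :: "(nat \<Rightarrow> nat) set" where "|A| =o |B|"
    unfolding internalize_card_of_ordLeq2[of A] by (elim exE conjE)
  then have "\<exists>B :: (nat \<Rightarrow> nat) set. |B| =o |A|"
    by (intro exI[of _ B]) (rule ordIso_symmetric)
  then have "|SOME B :: (nat \<Rightarrow> nat) set. |B| =o |A| | =o |A|"
    by (rule someI_ex)
  then show ?thesis
    unfolding csize_def by (intro exI conjI) (rule refl)
qed

lemma csize_le_iff:
  fixes A :: "'a set" and B :: "'b set"
  assumes "|UNIV :: 'a set| \<le>o |UNIV :: (nat \<Rightarrow> nat) set|"
    and "|UNIV :: 'b set| \<le>o |UNIV :: (nat \<Rightarrow> nat) set|"
  shows "csize A \<le> csize B \<longleftrightarrow> |A| \<le>o |B|"
proof -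
  obtain A' B' where "csize A = abs_ccard A'" "|A'| =o |A|" "csize B = abs_ccard B'" "|B'| =o |B|"
    using csize_rep[OF assms(1), of A] csize_rep[OF assms(2), of B] by blast
  then show ?thesis
    by (simp add: less_eq_ccard.abs_eq)
      (meson ordIso_ordLeq_trans ordIso_symmetric ordLeq_ordIso_trans)
qed

lemma csize_eq_iff:
  fixes A :: "'a set" and B :: "'b set"
  assumes "|UNIV :: 'a set| \<le>o |UNIV :: (nat \<Rightarrow> nat) set|"
    and "|UNIV :: 'b set| \<le>o |UNIV :: (nat \<Rightarrow> nat) set|"
  shows "csize A = csize B \<longleftrightarrow> |A| =o |B|"
  using csize_le_iff[OF assms] csize_le_iff[OF assms(2,1)]
  by (simp add: ordIso_iff_ordLeq order.eq_iff)

lemma card_pairs_slalom_le: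
  "|UNIV :: (nat set \<times> (nat \<Rightarrow> nat set)) set| \<le>o |UNIV :: (nat \<Rightarrow> nat) set|"
proof -
  define c :: "nat set \<times> (nat \<Rightarrow> nat set) \<Rightarrow> nat \<Rightarrow> nat" where
    "c = (\<lambda>(D, \<phi>) m. case prod_decode m of
      (i, j) \<Rightarrow> of_bool (case i of 0 \<Rightarrow> j \<in> D | Suc n \<Rightarrow> j \<in> \<phi> n))"
  have "inj c"
  proof (rule injI, clarify)
    fix D \<phi> D' \<phi>' assume eq: "c (D, \<phi>) = c (D', \<phi>')"
    have "j \<in> D \<longleftrightarrow> j \<in> D'" for j
      using fun_cong[OF eq, of "prod_encode (0, j)"] by (simp add: c_def of_bool_def split: if_splits)
    moreover have "j \<in> \<phi> n \<longleftrightarrow> j \<in> \<phi>' n" for j n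
      using fun_cong[OF eq, of "prod_encode (Suc n, j)"] by (simp add: c_def of_bool_def split: if_splits)
    ultimately show "D = D' \<and> \<phi> = \<phi>'"
      by (simp add: fun_eq_iff set_eq_iff)
  qed
  then show ?thesis
    using card_of_ordLeq[of UNIV UNIV] by blast
qed

lemma card_pairs_predictor_le:
  "|UNIV :: (nat set \<times> (nat \<Rightarrow> nat list \<Rightarrow> nat)) set| \<le>o |UNIV :: (nat \<Rightarrow> nat) set|"
proof -
  define c :: "nat set \<times> (nat \<Rightarrow> nat list \<Rightarrow> nat) \<Rightarrow> nat \<Rightarrow> nat" where
    "c = (\<lambda>(D, \<pi>) m. case prod_decode m of
      (i, j) \<Rightarrow> (case i of 0 \<Rightarrow> of_bool (j \<in> D) | Suc n \<Rightarrow> \<pi> n (list_decode j)))"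
  have "inj c"
  proof (rule injI, clarify)
    fix D \<pi> D' \<pi>' assume eq: "c (D, \<pi>) = c (D', \<pi>')"
    have "j \<in> D \<longleftrightarrow> j \<in> D'" for j
      using fun_cong[OF eq, of "prod_encode (0, j)"] by (simp add: c_def of_bool_def split: if_splits)
    moreover have "\<pi> n s = \<pi>' n s" for s n
      using fun_cong[OF eq, of "prod_encode (Suc n, list_encode s)"] by (simp add: c_def)
    ultimately show "D = D' \<and> \<pi> = \<pi>'"
      by (simp add: fun_eq_iff set_eq_iff)
  qed
  then show ?thesis
    using card_of_ordLeq[of UNIV UNIV] by blast
qed

section \<open>Slaloms and localization\<close>

text \<open>The ordinal \<open>b n \<le> \<omega>\<close> is an extended natural number, with \<open>\<infinity>\<close> standing for \<open>\<omega>\<close>.\<close>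

definition below :: "enat \<Rightarrow> nat set" where
  "below m = {k. enat k < m}"

definition seqs :: "(nat \<Rightarrow> enat) \<Rightarrow> (nat \<Rightarrow> nat) set" where
  "seqs b = {x. \<forall>n. x n \<in> below (b n)}"

definition slaloms :: "(nat \<Rightarrow> enat) \<Rightarrow> (nat \<Rightarrow> nat) \<Rightarrow> (nat \<Rightarrow> nat set) set" where
  "slaloms b h = {\<phi>. \<forall>n. \<phi> n \<subseteq> below (b n) \<and> finite (\<phi> n) \<and> card (\<phi> n) \<le> h n}"

definition localized :: "nat set \<Rightarrow> (nat \<Rightarrow> nat) \<Rightarrow> (nat \<Rightarrow> nat set) \<Rightarrow> bool" where
  "localized D x \<phi> \<longleftrightarrow> finite {n \<in> D. x n \<notin> \<phi> n}"

definition bLLc :: "(nat \<Rightarrow> enat) \<Rightarrow> (nat \<Rightarrow> nat) \<Rightarrow> ccard" where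
  "bLLc b h = (LEAST \<kappa>. \<exists>F. F \<subseteq> seqs b \<and>
     \<not> (\<exists>(D, \<phi>) \<in> {D. infinite D} \<times> slaloms b h. \<forall>x\<in>F. localized D x \<phi>) \<and> \<kappa> = csize F)"

definition dLLc :: "(nat \<Rightarrow> enat) \<Rightarrow> (nat \<Rightarrow> nat) \<Rightarrow> ccard" where
  "dLLc b h = (LEAST \<kappa>. \<exists>\<Phi>. \<Phi> \<subseteq> {D. infinite D} \<times> slaloms b h \<and>
     (\<forall>x \<in> seqs b. \<exists>(D, \<phi>) \<in> \<Phi>. localized D x \<phi>) \<and> \<kappa> = csize \<Phi>)"

text \<open>
  The bound \<open>h n < b n\<close> is the standing convention on the parameters; without it \<open>bLLc b h\<close>
  need not be defined, as a single slalom may then localize all of \<open>seqs b\<close>.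
\<close>

definition minLLc :: "(nat \<Rightarrow> nat) \<Rightarrow> ccard" where
  "minLLc h = (LEAST \<kappa>. \<exists>b :: nat \<Rightarrow> nat. (\<forall>n. h n < b n) \<and> \<kappa> = bLLc (\<lambda>n. enat (b n)) h)"

definition supLLc :: "(nat \<Rightarrow> nat) \<Rightarrow> ccard" where
  "supLLc h = (LEAST \<kappa>. \<forall>b :: nat \<Rightarrow> nat. (\<forall>n. h n < b n) \<longrightarrow> dLLc (\<lambda>n. enat (b n)) h \<le> \<kappa>)"

section \<open>Unbounding, dominating, evasion and prediction numbers\<close>

definition le_star :: "(nat \<Rightarrow> nat) \<Rightarrow> (nat \<Rightarrow> nat) \<Rightarrow> bool" where
  "le_star f g \<longleftrightarrow> finite {n. \<not> f n \<le> g n}"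

definition unbounding_number :: ccard where
  "unbounding_number = (LEAST \<kappa>. \<exists>F. \<not> (\<exists>g. \<forall>f\<in>F. le_star f g) \<and> \<kappa> = csize F)"

definition dominating_number :: ccard where
  "dominating_number = (LEAST \<kappa>. \<exists>G. (\<forall>f. \<exists>g\<in>G. le_star f g) \<and> \<kappa> = csize G)"

text \<open>
  Elements of \<open>\<omega>\<^sup>n\<close> are lists of length \<open>n\<close>. The functions are extensional, so each predictor is
  represented by exactly one pair.
\<close>

definition predictors :: "(nat set \<times> (nat \<Rightarrow> nat list \<Rightarrow> nat)) set" where
  "predictors = {(D, \<pi>). infinite D \<and> \<pi> \<in> (\<Pi>\<^sub>E n\<in>D. {s. length s = n} \<rightarrow>\<^sub>E UNIV)}"

definition predicts :: "nat set \<times> (nat \<Rightarrow> nat list \<Rightarrow> nat) \<Rightarrow> (nat \<Rightarrow> nat) \<Rightarrow> bool" where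
  "predicts p f \<longleftrightarrow> finite {n \<in> fst p. f n \<noteq> snd p n (map f [0..<n])}"

definition evasion_number :: ccard where
  "evasion_number = (LEAST \<kappa>. \<exists>F. \<not> (\<exists>p\<in>predictors. \<forall>f\<in>F. predicts p f) \<and> \<kappa> = csize F)"

definition prediction_number :: ccard where
  "prediction_number =
     (LEAST \<kappa>. \<exists>P. P \<subseteq> predictors \<and> (\<forall>f. \<exists>p\<in>P. predicts p f) \<and> \<kappa> = csize P)"

end

theory Submission
  imports Defs
begin

text \<open>
  All the cardinals are unbounding or dominating numbers of relational systems, and almost all the
  inequalities come from Tukey connections. A slalom localizing the increasing majorants of a family
  of functions on an infinite set yields a bound of the family, so \<open>\<omega>\<close>-localization is at least as
  hard as domination; conversely, a bound \<open>g\<close> of a family reduces its localization to that of a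
  family in \<open>\<Prod>b\<close> for a finite-valued \<open>b > g\<close>.
  A set of at most \<open>m\<close> sequences has fewer than \<open>m\<close> branching levels, so a slalom localizing the
  initial segments of \<open>f\<close> of length \<open>h 0 + \<dots> + h n\<close> has a non-branching level in the \<open>n\<close>-th block, where it
  predicts \<open>f\<close>. Finally, if \<open>h\<close> tends to infinity and \<open>a\<close> grows so fast that \<open>h (a m)\<close> is at least
  \<open>\<Prod>i<m. b (a i)\<close>, then a predictor of \<open>f \<circ> a\<close>, evaluated at all possible pasts, is a slalom localizing
  \<open>f \<in> \<Prod>b\<close>.
\<close>

section \<open>Cardinals of relational systems\<close>

text \<open>Lets an abstract cardinal be traded for an actual set of functions, so that cardinal
  arithmetic on sets applies to it.\<close>

lemma csize_surj: "\<exists>B :: (nat \<Rightarrow> nat) set. \<kappa> = csize B"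
proof -
  obtain A where A: "\<kappa> = abs_ccard A"
    using Quotient3_abs_rep[OF Quotient3_ccard, of \<kappa>] by metis
  obtain B where B: "csize A = abs_ccard B" "|B| =o |A|"
    using csize_rep[of A] card_of_mono1 subset_UNIV by blast
  have "abs_ccard B = abs_ccard A"
    using B(2) by (simp add: ccard.abs_eq_iff)
  then show ?thesis using A B by metis
qed

lemma csize_image_le:
  assumes "|UNIV :: 'a set| \<le>o |UNIV :: (nat \<Rightarrow> nat) set|"
    and "|UNIV :: 'b set| \<le>o |UNIV :: (nat \<Rightarrow> nat) set|"
  shows "csize ((f :: 'a \<Rightarrow> 'b) ` A) \<le> csize A"
  using csize_le_iff[OF assms(2,1)] card_of_image by blast

text \<open>A common upper bound for all cardinals of the type, so that the \<open>LEAST\<close> in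
  \<open>supLLc\<close> ranges over a nonempty set.\<close>

lemma csize_le_UNIV: "\<kappa> \<le> csize (UNIV :: (nat \<Rightarrow> nat) set)"
proof -
  obtain B :: "(nat \<Rightarrow> nat) set" where "\<kappa> = csize B" using csize_surj by blast
  then show ?thesis
    by (simp add: csize_le_iff card_of_mono1 ordLeq_refl)
qed

lemma card_Baire_le: "|UNIV :: (nat \<Rightarrow> nat) set| \<le>o |UNIV :: (nat \<Rightarrow> nat) set|"
  by (rule card_of_mono1) simp

section \<open>Relational systems and Tukey reductions\<close>

definition unbounded_in :: "'b set \<Rightarrow> ('a \<Rightarrow> 'b \<Rightarrow> bool) \<Rightarrow> 'a set \<Rightarrow> bool" where
  "unbounded_in Y R F \<longleftrightarrow> \<not> (\<exists>y\<in>Y. \<forall>x\<in>F. R x y)"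

definition dominating_in :: "'a set \<Rightarrow> ('a \<Rightarrow> 'b \<Rightarrow> bool) \<Rightarrow> 'b set \<Rightarrow> bool" where
  "dominating_in X R G \<longleftrightarrow> (\<forall>x\<in>X. \<exists>y\<in>G. R x y)"

text \<open>With \<open>dnum\<close>, the two cardinals of the relational system
  \<open>(X, Y, R)\<close>. The minima are taken over nonempty sets exactly when \<open>X\<close>
  itself is unbounded, respectively \<open>Y\<close> itself is dominating.\<close>

definition bnum :: "'a set \<Rightarrow> 'b set \<Rightarrow> ('a \<Rightarrow> 'b \<Rightarrow> bool) \<Rightarrow> ccard" where
  "bnum X Y R = (LEAST \<kappa>. \<exists>F. F \<subseteq> X \<and> unbounded_in Y R F \<and> \<kappa> = csize F)"

definition dnum :: "'a set \<Rightarrow> 'b set \<Rightarrow> ('a \<Rightarrow> 'b \<Rightarrow> bool) \<Rightarrow> ccard" where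
  "dnum X Y R = (LEAST \<kappa>. \<exists>G. G \<subseteq> Y \<and> dominating_in X R G \<and> \<kappa> = csize G)"

lemma bnum_le: "F \<subseteq> X \<Longrightarrow> unbounded_in Y R F \<Longrightarrow> bnum X Y R \<le> csize F"
  unfolding bnum_def by (rule Least_le) blast

lemma dnum_le: "G \<subseteq> Y \<Longrightarrow> dominating_in X R G \<Longrightarrow> dnum X Y R \<le> csize G"
  unfolding dnum_def by (rule Least_le) blast

lemma bnum_witness:
  assumes "unbounded_in Y R X"
  obtains F where "F \<subseteq> X" "unbounded_in Y R F" "csize F = bnum X Y R"
proof -
  have "\<exists>F. F \<subseteq> X \<and> unbounded_in Y R F \<and> bnum X Y R = csize F"
    unfolding bnum_def by (rule LeastI_ex) (use assms in blast)
  with that show ?thesis by metis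
qed

lemma dnum_witness:
  assumes "dominating_in X R Y"
  obtains G where "G \<subseteq> Y" "dominating_in X R G" "csize G = dnum X Y R"
proof -
  have "\<exists>G. G \<subseteq> Y \<and> dominating_in X R G \<and> dnum X Y R = csize G"
    unfolding dnum_def by (rule LeastI_ex) (use assms in blast)
  with that show ?thesis by metis
qed

text \<open>A Tukey reduction of \<open>(X, Y, R)\<close> to \<open>(X', Y', R')\<close>. The second
  map, from \<open>Y'\<close> to \<open>Y\<close>, is hidden in the quantifiers and is chosen only
  where dominating families are transported.\<close>

definition tukey ::
    "'a set \<Rightarrow> 'b set \<Rightarrow> ('a \<Rightarrow> 'b \<Rightarrow> bool) \<Rightarrow> 'c set \<Rightarrow> 'd set \<Rightarrow> ('c \<Rightarrow> 'd \<Rightarrow> bool) \<Rightarrow> bool" where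
  "tukey X Y R X' Y' R' \<longleftrightarrow>
     (\<exists>f. f ` X \<subseteq> X' \<and> (\<forall>y\<in>Y'. \<exists>z\<in>Y. \<forall>x\<in>X. R' (f x) y \<longrightarrow> R x z))"

text \<open>A bound of the image family pulls back to a bound of the original one, so the first map
  sends unbounded families to unbounded families.\<close>

lemma tukey_bnum:
  assumes "|UNIV :: 'a set| \<le>o |UNIV :: (nat \<Rightarrow> nat) set|"
    and "|UNIV :: 'c set| \<le>o |UNIV :: (nat \<Rightarrow> nat) set|"
    and "tukey X Y R X' Y' R'" and "unbounded_in Y R (X :: 'a set)"
  shows "bnum (X' :: 'c set) Y' R' \<le> bnum X Y R"
proof -
  obtain F where F: "F \<subseteq> X" "unbounded_in Y R F" "csize F = bnum X Y R"
    using bnum_witness[OF assms(4)] .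
  obtain f where f: "f ` X \<subseteq> X'" "\<forall>y\<in>Y'. \<exists>z\<in>Y. \<forall>x\<in>X. R' (f x) y \<longrightarrow> R x z"
    using assms(3) unfolding tukey_def by blast
  have "unbounded_in Y' R' (f ` F)"
    using F(1,2) f(2) unfolding unbounded_in_def by (metis imageI subsetD)
  then have "bnum X' Y' R' \<le> csize (f ` F)"
    using F(1) f(1) by (intro bnum_le) auto
  also have "\<dots> \<le> csize F" by (rule csize_image_le[OF assms(1,2)])
  finally show ?thesis using F(3) by simp
qed

text \<open>Dually, the second map sends dominating families to dominating families.\<close>

lemma tukey_dnum:
  assumes "|UNIV :: 'b set| \<le>o |UNIV :: (nat \<Rightarrow> nat) set|"
    and "|UNIV :: 'd set| \<le>o |UNIV :: (nat \<Rightarrow> nat) set|"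
    and "tukey X Y R X' Y' R'" and "dominating_in X' R' (Y' :: 'd set)"
  shows "dnum X (Y :: 'b set) R \<le> dnum X' Y' R'"
proof -
  obtain G where G: "G \<subseteq> Y'" "dominating_in X' R' G" "csize G = dnum X' Y' R'"
    using dnum_witness[OF assms(4)] .
  obtain f where f: "f ` X \<subseteq> X'" "\<forall>y\<in>Y'. \<exists>z\<in>Y. \<forall>x\<in>X. R' (f x) y \<longrightarrow> R x z"
    using assms(3) unfolding tukey_def by blast
  from f(2) obtain g where g: "\<And>y. y \<in> Y' \<Longrightarrow> g y \<in> Y"
    "\<And>y x. y \<in> Y' \<Longrightarrow> x \<in> X \<Longrightarrow> R' (f x) y \<Longrightarrow> R x (g y)" by metis
  have "dominating_in X R (g ` G)"
    unfolding dominating_in_def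
  proof
    fix x assume x: "x \<in> X"
    then obtain y where "y \<in> G" "R' (f x) y"
      using G(2) f(1) unfolding dominating_in_def by blast
    then show "\<exists>z\<in>g ` G. R x z" using g(2) x G(1) by blast
  qed
  then have "dnum X Y R \<le> csize (g ` G)"
    using G(1) g(1) by (intro dnum_le) auto
  also have "\<dots> \<le> csize G" by (rule csize_image_le[OF assms(2,1)])
  finally show ?thesis using G(3) by simp
qed

section \<open>The cardinals of the theorem as relational systems\<close>

abbreviation loc_pairs :: "(nat \<Rightarrow> enat) \<Rightarrow> (nat \<Rightarrow> nat) \<Rightarrow> (nat set \<times> (nat \<Rightarrow> nat set)) set" where
  "loc_pairs b h \<equiv> {D. infinite D} \<times> slaloms b h"

abbreviation loc :: "(nat \<Rightarrow> nat) \<Rightarrow> nat set \<times> (nat \<Rightarrow> nat set) \<Rightarrow> bool" where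
  "loc x p \<equiv> localized (fst p) x (snd p)"

lemma bLLc_bnum: "bLLc b h = bnum (seqs b) (loc_pairs b h) loc"
  unfolding bLLc_def bnum_def unbounded_in_def by (simp add: case_prod_beta)

lemma dLLc_dnum: "dLLc b h = dnum (seqs b) (loc_pairs b h) loc"
  unfolding dLLc_def dnum_def dominating_in_def by (simp add: case_prod_beta)

lemma unbounding_bnum: "unbounding_number = bnum UNIV UNIV le_star"
  unfolding unbounding_number_def bnum_def unbounded_in_def by simp

lemma dominating_dnum: "dominating_number = dnum UNIV UNIV le_star"
  unfolding dominating_number_def dnum_def dominating_in_def by simp

lemma evasion_bnum: "evasion_number = bnum UNIV predictors (\<lambda>f p. predicts p f)"
  unfolding evasion_number_def bnum_def unbounded_in_def by simp

lemma prediction_dnum: "prediction_number = dnum UNIV predictors (\<lambda>f p. predicts p f)"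
  unfolding prediction_number_def dnum_def dominating_in_def by simp

section \<open>Existence of unbounded and of dominating families\<close>

lemma unbounded_le_star: "unbounded_in UNIV le_star UNIV"
  unfolding unbounded_in_def
proof clarsimp
  fix g
  have "\<not> le_star (\<lambda>n. Suc (g n)) g" by (simp add: le_star_def)
  then show "\<exists>f. \<not> le_star f g" by blast
qed

lemma dominating_le_star: "dominating_in UNIV le_star UNIV"
  unfolding dominating_in_def
proof clarsimp
  fix f
  have "le_star f f" by (simp add: le_star_def)
  then show "\<exists>g. le_star f g" by blast
qed

text \<open>There are at least \<open>h n + 1\<close> values below \<open>b n\<close>, so a sequence
  can avoid a given slalom at every coordinate.\<close>

lemma unbounded_seqs:
  assumes "\<And>n. enat (h n) < b n"
  shows "unbounded_in (loc_pairs b h) loc (seqs b)"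
  unfolding unbounded_in_def
proof clarsimp
  fix D :: "nat set" and \<phi> assume D: "infinite D" and \<phi>: "\<phi> \<in> slaloms b h"
  have "\<exists>k. k \<in> below (b n) \<and> k \<notin> \<phi> n" for n
  proof (rule ccontr)
    assume "\<nexists>k. k \<in> below (b n) \<and> k \<notin> \<phi> n"
    moreover have "{..h n} \<subseteq> below (b n)"
      using assms[of n] by (auto simp: below_def intro: le_less_trans[of _ "enat (h n)"])
    ultimately have "{..h n} \<subseteq> \<phi> n" by blast
    moreover have "finite (\<phi> n)" "card (\<phi> n) \<le> h n" using \<phi> by (auto simp: slaloms_def)
    ultimately show False using card_mono[of "\<phi> n" "{..h n}"] by simp
  qed
  then obtain x where x: "\<And>n. x n \<in> below (b n)" "\<And>n. x n \<notin> \<phi> n" by metis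
  then have "x \<in> seqs b" "\<not> localized D x \<phi>"
    using D by (simp_all add: seqs_def localized_def)
  then show "\<exists>x\<in>seqs b. \<not> localized D x \<phi>" by blast
qed

lemma dominating_slaloms:
  assumes "\<And>n. 1 \<le> h n"
  shows "dominating_in (seqs b) loc (loc_pairs b h)"
  unfolding dominating_in_def
proof
  fix x assume "x \<in> seqs b"
  then have "(UNIV, \<lambda>n. {x n}) \<in> loc_pairs b h"
    using assms by (simp add: slaloms_def seqs_def)
  moreover have "loc x (UNIV, \<lambda>n. {x n})" by (simp add: localized_def)
  ultimately show "\<exists>p\<in>loc_pairs b h. loc x p" by blast
qed

lemma predictor_restrict:
  assumes "infinite D"
  shows "(D, \<lambda>n\<in>D. \<lambda>s\<in>{s. length s = n}. \<pi> n s) \<in> predictors"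
  using assms by (auto simp: predictors_def)

lemma predicts_restrict:
  "predicts (D, \<lambda>n\<in>D. \<lambda>s\<in>{s. length s = n}. \<pi> n s) f \<longleftrightarrow>
     finite {n \<in> D. f n \<noteq> \<pi> n (map f [0..<n])}"
  unfolding predicts_def by (rule arg_cong[of _ _ finite]) auto

lemma unbounded_predictors: "unbounded_in predictors (\<lambda>f p. predicts p f) UNIV"
  unfolding unbounded_in_def
proof (clarsimp)
  fix D \<pi> assume "(D, \<pi>) \<in> predictors"
  then have D: "infinite D" by (simp add: predictors_def)
  \<comment> \<open>Diagonalization: \<open>s n\<close> is the past of the sequence under
    construction, and each new value exceeds by one the prediction made from that past.\<close>
  define s where "s = rec_nat [] (\<lambda>n l. l @ [Suc (\<pi> n l)])"
  define f where "f = (\<lambda>n. Suc (\<pi> n (s n)))"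
  have "s n = map f [0..<n]" for n
    by (induction n) (simp_all add: s_def f_def)
  then have "f n \<noteq> \<pi> n (map f [0..<n])" for n
    by (metis f_def n_not_Suc_n)
  then have "\<not> predicts (D, \<pi>) f" using D by (simp add: predicts_def)
  then show "\<exists>f. \<not> predicts (D, \<pi>) f" by blast
qed

lemma dominating_predictors: "dominating_in UNIV (\<lambda>f p. predicts p f) predictors"
  unfolding dominating_in_def
proof
  fix f :: "nat \<Rightarrow> nat"
  let ?p = "(UNIV, \<lambda>n\<in>UNIV. \<lambda>s\<in>{s. length s = n}. f n)"
  have "?p \<in> predictors" by (rule predictor_restrict) simp
  moreover have "predicts ?p f" by (subst predicts_restrict) simp
  ultimately show "\<exists>p\<in>predictors. predicts p f" by blast
qed

section \<open>Tukey connections\<close>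

text \<open>Running maxima are monotone, so capturing one at a later element of \<open>D\<close>
  also bounds the value of \<open>f\<close> at \<open>n\<close>.\<close>

lemma tukey_le_star_localization:
  "tukey UNIV UNIV le_star (seqs (\<lambda>_. \<infinity>)) (loc_pairs (\<lambda>_. \<infinity>) h) loc"
  unfolding tukey_def
proof (intro exI[of _ "\<lambda>f n. Max (f ` {..n})"] conjI ballI)
  show "range (\<lambda>f n. Max (f ` {..n})) \<subseteq> seqs (\<lambda>_. \<infinity>)"
    by (simp add: seqs_def below_def)
  fix p assume p: "p \<in> loc_pairs (\<lambda>_. \<infinity>) h"
  obtain D \<phi> where p_eq: "p = (D, \<phi>)" by (cases p)
  have D: "infinite D" and \<phi>: "\<And>n. finite (\<phi> n)"
    using p by (auto simp: p_eq slaloms_def)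
  from D have "\<forall>n. \<exists>d\<in>D. n \<le> d" by (meson infinite_nat_iff_unbounded_le)
  then obtain d where d: "\<And>n. d n \<in> D" "\<And>n. n \<le> d n" by metis
  \<comment> \<open>\<open>Max\<close> of an empty set is unspecified, but this value is used only
    where the set contains the captured maximum.\<close>
  define g where "g n = Max (\<phi> (d n))" for n
  have "le_star f g" if "loc (\<lambda>n. Max (f ` {..n})) p" for f
  proof -
    let ?B = "{n \<in> D. Max (f ` {..n}) \<notin> \<phi> n}"
    have B: "finite ?B" using that by (simp add: p_eq localized_def)
    \<comment> \<open>A failure at \<open>n\<close> forces a failure of localization at
      \<open>d n\<close>, which is at least \<open>n\<close>; finitely many such points bound only
      finitely many \<open>n\<close>.\<close>
    have "{n. \<not> f n \<le> g n} \<subseteq> (\<Union>m\<in>?B. {..m})"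
    proof clarify
      fix n assume n: "\<not> f n \<le> g n"
      have "Max (f ` {..d n}) \<notin> \<phi> (d n)"
      proof
        assume "Max (f ` {..d n}) \<in> \<phi> (d n)"
        then have "Max (f ` {..d n}) \<le> g n" using \<phi> by (simp add: g_def)
        moreover have "f n \<le> Max (f ` {..d n})" using d(2) by simp
        ultimately show False using n le_trans by blast
      qed
      then show "n \<in> (\<Union>m\<in>?B. {..m})" using d by blast
    qed
    then show ?thesis
      unfolding le_star_def by (rule finite_subset) (use B in blast)
  qed
  then show "\<exists>g\<in>UNIV. \<forall>f\<in>UNIV. loc (\<lambda>n. Max (f ` {..n})) p \<longrightarrow> le_star f g"
    by blast
qed

text \<open>Sequences in \<open>seqs b\<close> never leave \<open>below (b n)\<close>, so cutting a
  slalom down to these sets loses nothing.\<close>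

lemma tukey_bounded_unbounded_localization:
  "tukey (seqs b) (loc_pairs b h) loc (seqs (\<lambda>_. \<infinity>)) (loc_pairs (\<lambda>_. \<infinity>) h) loc"
  unfolding tukey_def
proof (intro exI[of _ id] conjI ballI)
  show "id ` seqs b \<subseteq> seqs (\<lambda>_. \<infinity>)"
    by (auto simp: seqs_def below_def)
  fix p assume p: "p \<in> loc_pairs (\<lambda>_. \<infinity>) h"
  obtain D \<phi> where p_eq: "p = (D, \<phi>)" by (cases p)
  have D: "infinite D" and \<phi>: "\<And>n. finite (\<phi> n)" "\<And>n. card (\<phi> n) \<le> h n"
    using p by (auto simp: p_eq slaloms_def)
  let ?q = "(D, \<lambda>n. \<phi> n \<inter> below (b n))"
  have "card (\<phi> n \<inter> below (b n)) \<le> h n" for n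
    by (meson \<phi> card_mono Int_lower1 le_trans)
  then have "?q \<in> loc_pairs b h"
    using D \<phi> by (simp add: slaloms_def)
  moreover have "loc x ?q" if "x \<in> seqs b" "loc (id x) p" for x
    using that by (simp add: p_eq localized_def seqs_def)
  ultimately show "\<exists>q\<in>loc_pairs b h. \<forall>x\<in>seqs b. loc (id x) p \<longrightarrow> loc x q" by blast
qed

text \<open>The number of restrictions of members of \<open>S\<close> to length \<open>k\<close>
  starts at 1, grows strictly at each branching level and never exceeds
  \<open>card S\<close>.\<close>

lemma card_branching_less:
  fixes S :: "(nat \<Rightarrow> 'a) set"
  assumes S: "finite S" "S \<noteq> {}"
  defines "br \<equiv> \<lambda>k. \<exists>s\<in>S. \<exists>t\<in>S. map s [0..<k] = map t [0..<k] \<and> s k \<noteq> t k"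
  shows "card {k. k < n \<and> br k} < card S"
proof -
  define T where "T k = (\<lambda>s. map s [0..<k]) ` S" for k
  have fin: "finite (T k)" for k using S by (simp add: T_def)
  have T_butlast: "T k = butlast ` T (Suc k)" for k
    by (simp add: T_def image_image)
  have "card {k. k < n \<and> br k} < card (T n)" for n
  proof (induction n)
    case 0
    then show ?case using S fin[of 0] by (simp add: card_gt_0_iff T_def)
  next
    case (Suc n)
    show ?case
    proof (cases "br n")
      case True
      then obtain s t where st: "s \<in> S" "t \<in> S" "map s [0..<n] = map t [0..<n]" "s n \<noteq> t n"
        by (auto simp: br_def)
      \<comment> \<open>\<open>butlast\<close> maps the restrictions of length \<open>Suc n\<close>
        onto those of length \<open>n\<close>; two sequences that split at \<open>n\<close> make it
        non-injective.\<close>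
      have "\<not> inj_on butlast (T (Suc n))"
      proof
        assume "inj_on butlast (T (Suc n))"
        then have "map s [0..<Suc n] = map t [0..<Suc n]"
          by (rule inj_onD) (use st in \<open>auto simp: T_def\<close>)
        then show False using st(4) by simp
      qed
      then have "card (T n) < card (T (Suc n))"
        unfolding T_butlast[of n] using fin by (meson card_image_le eq_card_imp_inj_on le_neq_implies_less)
      moreover have "{k. k < Suc n \<and> br k} = insert n {k. k < n \<and> br k}"
        using True by (auto simp: less_Suc_eq)
      ultimately show ?thesis using Suc by simp
    next
      case False
      then have "{k. k < Suc n \<and> br k} = {k. k < n \<and> br k}"
        by (auto simp: less_Suc_eq)
      moreover have "card (T n) \<le> card (T (Suc n))"
        unfolding T_butlast[of n] by (rule card_image_le[OF fin])
      ultimately show ?thesis using Suc by simp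
    qed
  qed
  moreover have "card (T n) \<le> card S" unfolding T_def by (rule card_image_le[OF S(1)])
  ultimately show ?thesis using less_le_trans by blast
qed

text \<open>Pigeonhole: among \<open>m\<close> consecutive levels fewer than \<open>m\<close> can
  branch. The empty set is separate, as the strict count needs a member.\<close>

lemma ex_nonbranching_level:
  fixes S :: "(nat \<Rightarrow> 'a) set"
  assumes "finite S" "card S \<le> m" "1 \<le> m"
  shows "\<exists>k. l \<le> k \<and> k < l + m \<and>
    (\<forall>s\<in>S. \<forall>t\<in>S. map s [0..<k] = map t [0..<k] \<longrightarrow> s k = t k)"
proof (cases "S = {}")
  case True
  then show ?thesis using assms(3) by (intro exI[of _ l]) simp
next
  case False
  define br where "br \<equiv> \<lambda>k. \<exists>s\<in>S. \<exists>t\<in>S. map s [0..<k] = map t [0..<k] \<and> s k \<noteq> t k"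
  have "\<not> {l..<l + m} \<subseteq> {k. k < l + m \<and> br k}"
  proof
    assume "{l..<l + m} \<subseteq> {k. k < l + m \<and> br k}"
    then have "card {l..<l + m} \<le> card {k. k < l + m \<and> br k}" by (intro card_mono) auto
    also have "\<dots> < card S"
      unfolding br_def by (rule card_branching_less[OF assms(1) False])
    finally show False using assms(2) by simp
  qed
  then obtain k where "l \<le> k" "k < l + m" "\<not> br k"
    by (metis (no_types, lifting) atLeastLessThan_iff mem_Collect_eq subsetI)
  then show ?thesis unfolding br_def by blast
qed

text \<open>The n-th block of levels has length \<open>h n\<close>, so the at most
  \<open>h n\<close> segments listed by the n-th slalom set share a non-branching level in it, where
  the past determines the next value.\<close>

lemma tukey_prediction_localization:
  assumes h: "\<And>n. 1 \<le> h n"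
  shows "tukey UNIV predictors (\<lambda>f p. predicts p f) (seqs (\<lambda>_. \<infinity>)) (loc_pairs (\<lambda>_. \<infinity>) h) loc"
  unfolding tukey_def
proof -
  define H where "H n = (\<Sum>i<n. h i)" for n
  have H_Suc: "H (Suc n) = H n + h n" for n by (simp add: H_def)
  \<comment> \<open>The coded segment reaches the end of the n-th block, so wherever in the block
    the level lies, both the past and the value there are recorded.\<close>
  define c where "c f n = list_encode (map f [0..<H (Suc n)])" for f n
  show "\<exists>c. range c \<subseteq> seqs (\<lambda>_. \<infinity>) \<and>
    (\<forall>p\<in>loc_pairs (\<lambda>_. \<infinity>) h. \<exists>q\<in>predictors. \<forall>f\<in>UNIV. loc (c f) p \<longrightarrow> predicts q f)"
  proof (intro exI[of _ c] conjI ballI)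
    show "range c \<subseteq> seqs (\<lambda>_. \<infinity>)" by (simp add: seqs_def below_def)
    fix p assume p: "p \<in> loc_pairs (\<lambda>_. \<infinity>) h"
    obtain D \<phi> where p_eq: "p = (D, \<phi>)" by (cases p)
    have D: "infinite D" and \<phi>: "\<And>n. finite (\<phi> n)" "\<And>n. card (\<phi> n) \<le> h n"
      using p by (auto simp: p_eq slaloms_def)
    \<comment> \<open>Reading past the end of a decoded list gives unspecified values. This is
      harmless: non-branching levels exist for arbitrary sequences, and the code of \<open>f\<close>
      itself is long enough.\<close>
    define S where "S n = (\<lambda>c i. list_decode c ! i) ` \<phi> n" for n
    have "finite (S n)" "card (S n) \<le> h n" for n
      unfolding S_def using \<phi> by (auto intro: le_trans[OF card_image_le])
    then have "\<exists>k. H n \<le> k \<and> k < H n + h n \<and>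
        (\<forall>s\<in>S n. \<forall>t\<in>S n. map s [0..<k] = map t [0..<k] \<longrightarrow> s k = t k)" for n
      using h by (intro ex_nonbranching_level)
    then obtain k where k: "\<And>n. H n \<le> k n" "\<And>n. k n < H (Suc n)"
      and nb: "\<And>n s t. s \<in> S n \<Longrightarrow> t \<in> S n \<Longrightarrow> map s [0..<k n] = map t [0..<k n] \<Longrightarrow> s (k n) = t (k n)"
      unfolding H_Suc by metis
    \<comment> \<open>The levels lie in consecutive disjoint blocks, so \<open>inv k\<close>
      recovers the block and the image of \<open>D\<close> stays infinite.\<close>
    have "strict_mono k"
      unfolding strict_mono_Suc_iff using k less_le_trans by blast
    then have inj: "inj k" by (rule strict_mono_imp_inj_on)
    \<comment> \<open>Predict by any listed sequence extending the past \<open>s\<close>; if there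
      is none, the value is arbitrary.\<close>
    define \<pi> where "\<pi> j s = (SOME v. \<exists>t \<in> S (inv k j). map t [0..<j] = s \<and> v = t j)" for j s
    let ?q = "(k ` D, \<lambda>n\<in>k ` D. \<lambda>s\<in>{s. length s = n}. \<pi> n s)"
    have "?q \<in> predictors"
      by (rule predictor_restrict) (use D inj in \<open>simp add: finite_image_iff inj_on_subset\<close>)
    moreover have "predicts ?q f" if "loc (c f) p" for f
    proof -
      have correct: "f (k n) = \<pi> (k n) (map f [0..<k n])" if n: "c f n \<in> \<phi> n" for n
      proof -
        define t where "t = (\<lambda>i. list_decode (c f n) ! i)"
        have t: "t \<in> S n" unfolding S_def t_def using n by (rule imageI)
        have t_eq: "t i = f i" if "i < H (Suc n)" for i
          using that by (simp add: t_def c_def del: upt_Suc)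
        then have map_t: "map t [0..<k n] = map f [0..<k n]" "t (k n) = f (k n)"
          using k(2)[of n] by auto
        let ?P = "\<lambda>v. \<exists>t \<in> S n. map t [0..<k n] = map f [0..<k n] \<and> v = t (k n)"
        \<comment> \<open>The segment of \<open>f\<close> itself is a candidate, so by non-branching
          every candidate gives the value \<open>f (k n)\<close>.\<close>
        have "?P (t (k n))" using t map_t by blast
        then have "?P (Eps ?P)" by (rule someI)
        then have "Eps ?P = t (k n)" using nb t map_t(1) by metis
        then show ?thesis by (simp add: \<pi>_def inj map_t)
      qed
      have "{j \<in> k ` D. f j \<noteq> \<pi> j (map f [0..<j])} \<subseteq> k ` {n \<in> D. c f n \<notin> \<phi> n}"
        using correct by auto
      moreover have "finite (k ` {n \<in> D. c f n \<notin> \<phi> n})"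
        using that by (simp add: p_eq localized_def)
      ultimately show ?thesis
        unfolding predicts_restrict by (rule finite_subset)
    qed
    ultimately show "\<exists>q\<in>predictors. \<forall>f\<in>UNIV. loc (c f) p \<longrightarrow> predicts q f" by blast
  qed
qed

lemma ex_sparse_sequence:
  fixes b h :: "nat \<Rightarrow> nat"
  assumes h: "\<And>n. 1 \<le> h n" "filterlim h at_top sequentially" and b: "\<And>n. 1 \<le> b n"
  shows "\<exists>a :: nat \<Rightarrow> nat. strict_mono a \<and> (\<forall>m. (\<Prod>i<m. b (a i)) \<le> h (a m))"
proof -
  \<comment> \<open>Multiplying over all indices up to \<open>a m\<close>, rather than over the
    chosen ones only, makes the requirement depend on the previous term alone, so dependent choice
    applies.\<close>
  have "\<exists>a. \<forall>m. a m < a (Suc m) \<and> (\<Prod>i\<le>a m. b i) \<le> h (a (Suc m))"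
  proof -
    have "\<exists>y. x < y \<and> (\<Prod>i\<le>x. b i) \<le> h y" for x
    proof -
      have "eventually (\<lambda>y. (\<Prod>i\<le>x. b i) \<le> h y) sequentially"
        using h(2) by (simp add: filterlim_at_top)
      then have "eventually (\<lambda>y. x < y \<and> (\<Prod>i\<le>x. b i) \<le> h y) sequentially"
        using eventually_gt_at_top eventually_conj by blast
      then show ?thesis using eventually_happens by fastforce
    qed
    then show ?thesis
      using dependent_nat_choice[of "\<lambda>_ _. True" "\<lambda>_ x y. x < y \<and> (\<Prod>i\<le>x. b i) \<le> h y"] by simp
  qed
  then obtain a where a: "\<And>m. a m < a (Suc m)" "\<And>m. (\<Prod>i\<le>a m. b i) \<le> h (a (Suc m))" by blast
  have mono: "strict_mono a" using a(1) by (simp add: strict_mono_Suc_iff)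
  have "(\<Prod>i<m. b (a i)) \<le> h (a m)" for m
  proof (cases m)
    \<comment> \<open>The empty product is 1, so this case rests on
      \<open>1 \<le> h n\<close>.\<close>
    case 0
    then show ?thesis using h(1)[of "a 0"] by simp
  next
    case (Suc l)
    have "(\<Prod>i<Suc l. b (a i)) = prod b (a ` {..<Suc l})"
      using strict_mono_imp_inj_on[OF mono] by (simp add: prod.reindex inj_on_subset)
    also have "\<dots> \<le> (\<Prod>i\<le>a l. b i)"
    proof (rule dvd_imp_le)
      show "prod b (a ` {..<Suc l}) dvd (\<Prod>i\<le>a l. b i)"
        using mono by (intro prod_dvd_prod_subset) (auto simp: less_Suc_eq_le strict_mono_less_eq)
      show "0 < (\<Prod>i\<le>a l. b i)"
        using b by (intro prod_pos) (simp add: Suc_le_eq)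
    qed
    also have "\<dots> \<le> h (a m)" using a(2) Suc by simp
    finally show ?thesis using Suc by simp
  qed
  with mono show ?thesis by (intro exI[of _ a]) simp
qed

text \<open>For \<open>x\<close> in the bounded product, \<open>x \<circ> a\<close> has at most
  \<open>h (a m)\<close> possible pasts of length \<open>m\<close>, so a predictor leaves at most
  that many candidates for \<open>x (a m)\<close>.\<close>

lemma tukey_localization_prediction:
  fixes b h :: "nat \<Rightarrow> nat"
  assumes h: "\<And>n. 1 \<le> h n" "filterlim h at_top sequentially" and b: "\<And>n. 1 \<le> b n"
  shows "tukey (seqs (\<lambda>n. enat (b n))) (loc_pairs (\<lambda>n. enat (b n)) h) loc
    UNIV predictors (\<lambda>f p. predicts p f)"
  unfolding tukey_def
proof -
  obtain a :: "nat \<Rightarrow> nat" where a: "strict_mono a"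
    and prod_le: "\<And>m. (\<Prod>i<m. b (a i)) \<le> h (a m)"
    using ex_sparse_sequence[of h b, OF assms] by blast
  have inj: "inj a" by (rule strict_mono_imp_inj_on[OF a])
  let ?b = "\<lambda>n. enat (b n)"
  show "\<exists>c. c ` seqs ?b \<subseteq> UNIV \<and>
    (\<forall>p\<in>predictors. \<exists>q\<in>loc_pairs ?b h. \<forall>x\<in>seqs ?b. predicts p (c x) \<longrightarrow> loc x q)"
  proof (intro exI[of _ "\<lambda>x. x \<circ> a"] conjI ballI)
    fix p assume p: "p \<in> predictors"
    obtain D \<pi> where p_eq: "p = (D, \<pi>)" by (cases p)
    have D: "infinite D" using p by (simp add: p_eq predictors_def)
    define pasts where "pasts m = (\<Pi>\<^sub>E i\<in>{..<m}. {..<b (a i)})" for m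
    \<comment> \<open>The intersection discards predicted values outside the range allowed by
      \<open>b\<close>, as a slalom for \<open>b\<close> requires.\<close>
    define G where "G m = (\<lambda>x. \<pi> m (map x [0..<m])) ` pasts m \<inter> {..<b (a m)}" for m
    \<comment> \<open>Off the range of \<open>a\<close> the slalom can be empty, since localization
      is tested only on the image of \<open>D\<close>.\<close>
    define \<phi> where "\<phi> n = (if n \<in> range a then G (inv a n) else {})" for n
    have \<phi>_a: "\<phi> (a m) = G m" for m by (simp add: \<phi>_def inj)
    have fin: "finite (pasts m)" for m by (simp add: pasts_def finite_PiE)
    have "card (G m) \<le> h (a m)" for m
    proof -
      have "card (G m) \<le> card ((\<lambda>x. \<pi> m (map x [0..<m])) ` pasts m)"
        unfolding G_def by (intro card_mono) (auto simp: fin)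
      also have "\<dots> \<le> card (pasts m)" by (rule card_image_le[OF fin])
      also have "\<dots> = (\<Prod>i<m. b (a i))" by (simp add: pasts_def card_PiE)
      also have "\<dots> \<le> h (a m)" by (rule prod_le)
      finally show ?thesis .
    qed
    moreover have "finite (G m)" "G m \<subseteq> {..<b (a m)}" for m by (auto simp: G_def)
    ultimately have "\<phi> \<in> slaloms ?b h"
      by (auto simp: slaloms_def \<phi>_def below_def inj subset_iff)
    then have "(a ` D, \<phi>) \<in> loc_pairs ?b h"
      using D inj by (simp add: finite_image_iff inj_on_subset)
    moreover have "loc x (a ` D, \<phi>)" if x: "x \<in> seqs ?b" and pr: "predicts p (x \<circ> a)" for x
    proof -
      have "x (a m) \<in> G m" if "(x \<circ> a) m = \<pi> m (map (x \<circ> a) [0..<m])" for m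
      proof -
        \<comment> \<open>Members of \<open>pasts m\<close> are extensional, so
          \<open>x \<circ> a\<close> is cut to \<open>{..<m}\<close>; the list fed to the predictor
          is unchanged.\<close>
        let ?y = "restrict (x \<circ> a) {..<m}"
        have "map ?y [0..<m] = map (x \<circ> a) [0..<m]" by simp
        then have "x (a m) = \<pi> m (map ?y [0..<m])" using that by (simp only: comp_apply)
        moreover have "?y \<in> pasts m" "x (a m) < b (a m)"
          using x by (auto simp: pasts_def seqs_def below_def)
        ultimately show ?thesis
          unfolding G_def by (intro IntI image_eqI[where x = ?y]) (simp_all only: lessThan_iff)
      qed
      then have "{n \<in> a ` D. x n \<notin> \<phi> n} \<subseteq> a ` {m \<in> D. (x \<circ> a) m \<noteq> \<pi> m (map (x \<circ> a) [0..<m])}"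
        by (auto simp: \<phi>_a)
      moreover have "finite (a ` {m \<in> D. (x \<circ> a) m \<noteq> \<pi> m (map (x \<circ> a) [0..<m])})"
        using pr by (simp add: predicts_def p_eq)
      ultimately show ?thesis
        unfolding localized_def fst_conv snd_conv by (rule finite_subset)
    qed
    ultimately show "\<exists>q\<in>loc_pairs ?b h. \<forall>x\<in>seqs ?b. predicts p (x \<circ> a) \<longrightarrow> loc x q" by blast
  qed simp
qed

section \<open>Localization of bounded families\<close>

text \<open>Truncating at an eventual bound changes only finitely many values.\<close>

lemma localized_truncation:
  assumes "le_star x g" "localized D (\<lambda>n. min (x n) (g n)) \<phi>"
  shows "localized D x \<phi>"
proof -
  have "{n \<in> D. x n \<notin> \<phi> n} \<subseteq> {n. \<not> x n \<le> g n} \<union> {n \<in> D. min (x n) (g n) \<notin> \<phi> n}"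
    by (auto simp: min_def)
  then show ?thesis
    using assms unfolding localized_def le_star_def by (meson finite_Un finite_subset)
qed

text \<open>This parameter exceeds \<open>g\<close>, to hold the truncation, and \<open>h\<close>,
  to meet the convention on parameters.\<close>

lemma truncation_in_seqs: "(\<lambda>n. min (x n) (g n)) \<in> seqs (\<lambda>n. enat (Suc (max (g n) (h n))))"
  by (auto simp: seqs_def below_def)

lemma slaloms_mono_infinity: "slaloms b h \<subseteq> slaloms (\<lambda>_. \<infinity>) h"
  by (auto simp: slaloms_def below_def)

section \<open>Minimum and supremum over finite-valued parameters\<close>

lemma minLLc_le:
  fixes b :: "nat \<Rightarrow> nat"
  shows "(\<And>n. h n < b n) \<Longrightarrow> minLLc h \<le> bLLc (\<lambda>n. enat (b n)) h"
  unfolding minLLc_def by (rule Least_le) blast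

lemma minLLc_attained:
  obtains b :: "nat \<Rightarrow> nat" where "\<And>n. h n < b n" "minLLc h = bLLc (\<lambda>n. enat (b n)) h"
proof -
  have "\<exists>b :: nat \<Rightarrow> nat. (\<forall>n. h n < b n) \<and> minLLc h = bLLc (\<lambda>n. enat (b n)) h"
    unfolding minLLc_def
    by (rule LeastI_ex) (rule exI, rule exI[of _ "\<lambda>n. Suc (h n)"], simp)
  with that show ?thesis by blast
qed

lemma supLLc_upper:
  fixes b :: "nat \<Rightarrow> nat"
  assumes "\<And>n. h n < b n"
  shows "dLLc (\<lambda>n. enat (b n)) h \<le> supLLc h"
proof -
  have "\<forall>b :: nat \<Rightarrow> nat. (\<forall>n. h n < b n) \<longrightarrow> dLLc (\<lambda>n. enat (b n)) h \<le> supLLc h"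
    unfolding supLLc_def by (rule LeastI_ex) (use csize_le_UNIV in blast)
  then show ?thesis using assms by blast
qed

lemma supLLc_least:
  assumes "\<And>b :: nat \<Rightarrow> nat. (\<And>n. h n < b n) \<Longrightarrow> dLLc (\<lambda>n. enat (b n)) h \<le> \<kappa>"
  shows "supLLc h \<le> \<kappa>"
  unfolding supLLc_def by (rule Least_le) (use assms in blast)

text \<open>A family smaller than both cardinals has a bound \<open>g\<close>. Its truncations at
  \<open>g\<close> are too few to be unlocalizable in the finite-valued product, and a pair
  localizing them localizes the family. The parameter depends on \<open>g\<close>, so no single
  Tukey reduction is used.\<close>

lemma min_unbounding_minLLc_le: "min unbounding_number (minLLc h) \<le> bLLc (\<lambda>_. \<infinity>) h"
proof (rule ccontr)
  assume "\<not> ?thesis"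
  then have less: "bLLc (\<lambda>_. \<infinity>) h < unbounding_number" "bLLc (\<lambda>_. \<infinity>) h < minLLc h"
    by (simp_all add: min_le_iff_disj not_le)
  obtain F where F: "F \<subseteq> seqs (\<lambda>_. \<infinity>)" "unbounded_in (loc_pairs (\<lambda>_. \<infinity>) h) loc F"
      "csize F = bLLc (\<lambda>_. \<infinity>) h"
    using bnum_witness[OF unbounded_seqs[of h "\<lambda>_. \<infinity>"]] by (auto simp: bLLc_bnum)
  have "\<not> unbounded_in UNIV le_star F"
    using bnum_le[of F UNIV UNIV le_star] less(1) F(3) unfolding unbounding_bnum by auto
  then obtain g where g: "\<And>x. x \<in> F \<Longrightarrow> le_star x g" by (auto simp: unbounded_in_def)
  let ?b = "\<lambda>n. Suc (max (g n) (h n))" and ?t = "\<lambda>x n. min (x n) (g n)"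
  have "csize (?t ` F) \<le> csize F" by (rule csize_image_le[OF card_Baire_le card_Baire_le])
  also have "\<dots> < minLLc h" using F(3) less(2) by simp
  also have "\<dots> \<le> bLLc (\<lambda>n. enat (?b n)) h" by (rule minLLc_le) simp
  finally have less_b: "csize (?t ` F) < bLLc (\<lambda>n. enat (?b n)) h" .
  have "\<not> unbounded_in (loc_pairs (\<lambda>n. enat (?b n)) h) loc (?t ` F)"
  proof
    assume "unbounded_in (loc_pairs (\<lambda>n. enat (?b n)) h) loc (?t ` F)"
    then have "bLLc (\<lambda>n. enat (?b n)) h \<le> csize (?t ` F)"
      unfolding bLLc_bnum by (intro bnum_le image_subsetI truncation_in_seqs)
    with less_b show False by simp
  qed
  then obtain D \<phi> where q: "infinite D" "\<phi> \<in> slaloms (\<lambda>n. enat (?b n)) h"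
    "\<And>x. x \<in> F \<Longrightarrow> localized D (?t x) \<phi>"
    unfolding unbounded_in_def by auto
  have "\<forall>x\<in>F. loc x (D, \<phi>)"
    using localized_truncation[OF g q(3)] by simp
  moreover have "(D, \<phi>) \<in> loc_pairs (\<lambda>_. \<infinity>) h"
    using q slaloms_mono_infinity by blast
  ultimately show False using F(2) unfolding unbounded_in_def by blast
qed

text \<open>One more than the sum of finitely many functions exceeds each of them. Infinity is what
  lets a union of families be absorbed in the cardinal estimate.\<close>

lemma infinite_dominating:
  assumes "dominating_in UNIV le_star G"
  shows "infinite G"
proof
  assume fin: "finite G"
  let ?f = "\<lambda>n. Suc (\<Sum>g\<in>G. g n)"
  obtain g where g: "g \<in> G" "le_star ?f g"
    using assms by (auto simp: dominating_in_def)
  have "\<not> ?f n \<le> g n" for n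
    using member_le_sum[OF g(1), of "\<lambda>g. g n"] fin by simp
  then show False using g(2) by (simp add: le_star_def)
qed

text \<open>For each \<open>g\<close> in a dominating family, choose a localizing family for the
  product cut off above \<open>g\<close>. Every \<open>x\<close> is localized through its truncation
  at some \<open>g\<close>, so the union of the chosen families suffices.\<close>

lemma dLLc_le_max_dominating_supLLc:
  assumes h: "\<And>n. 1 \<le> h n"
  shows "dLLc (\<lambda>_. \<infinity>) h \<le> max dominating_number (supLLc h)"
proof -
  obtain B :: "(nat \<Rightarrow> nat) set" where B: "max dominating_number (supLLc h) = csize B"
    using csize_surj by blast
  obtain G where G: "dominating_in UNIV le_star G" "csize G = dominating_number"
    using dnum_witness[OF dominating_le_star] unfolding dominating_dnum by blast
  have GB: "|G| \<le>o |B|"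
    using G(2) B csize_le_iff[OF card_Baire_le card_Baire_le, of G B] by (metis max.cobounded1)
  have inf: "infinite B"
    using GB infinite_dominating[OF G(1)] card_of_ordLeq_infinite by blast
  let ?b = "\<lambda>g n. Suc (max (g n) (h n))"
  let ?Y = "\<lambda>g. loc_pairs (\<lambda>n. enat (?b g n)) h" and ?X = "\<lambda>g. seqs (\<lambda>n. enat (?b g n))"
  have "\<forall>g. \<exists>\<Phi>. \<Phi> \<subseteq> ?Y g \<and> dominating_in (?X g) loc \<Phi> \<and> |\<Phi>| \<le>o |B|"
  proof
    fix g :: "nat \<Rightarrow> nat"
    obtain \<Phi> where \<Phi>: "\<Phi> \<subseteq> ?Y g" "dominating_in (?X g) loc \<Phi>" "csize \<Phi> = dLLc (\<lambda>n. enat (?b g n)) h"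
      by (rule dnum_witness[OF dominating_slaloms[of h "\<lambda>n. enat (?b g n)", OF h]])
        (simp add: dLLc_dnum)
    have "csize \<Phi> \<le> supLLc h" unfolding \<Phi>(3) by (rule supLLc_upper) simp
    then have "csize \<Phi> \<le> csize B" using B by (metis max.coboundedI2)
    then show "\<exists>\<Phi>. \<Phi> \<subseteq> ?Y g \<and> dominating_in (?X g) loc \<Phi> \<and> |\<Phi>| \<le>o |B|"
      using \<Phi> csize_le_iff[OF card_pairs_slalom_le card_Baire_le] by blast
  qed
  from choice[OF this] obtain \<Phi> where
    "\<forall>g. \<Phi> g \<subseteq> ?Y g \<and> dominating_in (?X g) loc (\<Phi> g) \<and> |\<Phi> g| \<le>o |B|" ..
  then have \<Phi>: "\<Phi> g \<subseteq> ?Y g" "dominating_in (?X g) loc (\<Phi> g)" "|\<Phi> g| \<le>o |B|" for g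
    by simp_all
  \<comment> \<open>At most \<open>|B|\<close> many sets, each of size at most \<open>|B|\<close>,
    with \<open>B\<close> infinite.\<close>
  have "|\<Union>g\<in>G. \<Phi> g| \<le>o |B|"
    by (rule card_of_UNION_ordLeq_infinite[OF inf GB]) (use \<Phi>(3) in blast)
  then have "csize (\<Union>g\<in>G. \<Phi> g) \<le> csize B"
    using csize_le_iff[OF card_pairs_slalom_le card_Baire_le] by blast
  moreover have "dLLc (\<lambda>_. \<infinity>) h \<le> csize (\<Union>g\<in>G. \<Phi> g)"
    unfolding dLLc_dnum
  proof (rule dnum_le)
    show "(\<Union>g\<in>G. \<Phi> g) \<subseteq> loc_pairs (\<lambda>_. \<infinity>) h"
      using \<Phi>(1) slaloms_mono_infinity by blast
    show "dominating_in (seqs (\<lambda>_. \<infinity>)) loc (\<Union>g\<in>G. \<Phi> g)"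
      unfolding dominating_in_def
    proof
      fix x :: "nat \<Rightarrow> nat"
      obtain g where g: "g \<in> G" "le_star x g" using G(1) by (auto simp: dominating_in_def)
      obtain p where p: "p \<in> \<Phi> g" "loc (\<lambda>n. min (x n) (g n)) p"
        using \<Phi>(2)[of g] truncation_in_seqs unfolding dominating_in_def by blast
      then show "\<exists>p\<in>\<Union>g\<in>G. \<Phi> g. loc x p"
        using g localized_truncation by blast
    qed
  qed
  ultimately show ?thesis using B by simp
qed

section \<open>Derivation of the identities from the inequalities\<close>

theorem theorem2p10:
  fixes h :: "nat \<Rightarrow> nat"
  assumes "\<forall>n. 1 \<le> h n"
    and "filterlim h at_top sequentially"
  shows "bLLc (\<lambda>_. \<infinity>) h = min unbounding_number (minLLc h)
    \<and> dLLc (\<lambda>_. \<infinity>) h = max dominating_number (supLLc h)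
    \<and> min unbounding_number evasion_number = min unbounding_number (minLLc h)
    \<and> max dominating_number prediction_number = max dominating_number (supLLc h)"
proof -
  have h: "\<And>n. 1 \<le> h n" using assms(1) by blast
  have b_le: "bLLc (\<lambda>_. \<infinity>) h \<le> unbounding_number"
    unfolding bLLc_bnum unbounding_bnum
    by (rule tukey_bnum[OF card_Baire_le card_Baire_le tukey_le_star_localization unbounded_le_star])
  have d_le: "dominating_number \<le> dLLc (\<lambda>_. \<infinity>) h"
    unfolding dLLc_dnum dominating_dnum
    by (rule tukey_dnum[OF card_Baire_le card_pairs_slalom_le tukey_le_star_localization
          dominating_slaloms[OF h]])
  have e_ge: "bLLc (\<lambda>_. \<infinity>) h \<le> evasion_number"
    unfolding bLLc_bnum evasion_bnum
    by (rule tukey_bnum[OF card_Baire_le card_Baire_le tukey_prediction_localization[OF h]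
          unbounded_predictors])
  have pr_le: "prediction_number \<le> dLLc (\<lambda>_. \<infinity>) h"
    unfolding dLLc_dnum prediction_dnum
    by (rule tukey_dnum[OF card_pairs_predictor_le card_pairs_slalom_le
          tukey_prediction_localization[OF h] dominating_slaloms[OF h]])
  \<comment> \<open>The minimum is attained, so one parameter suffices for the upper bounds on the
    b-side; on the d-side the supremum is handled by treating every parameter separately.\<close>
  obtain b0 :: "nat \<Rightarrow> nat" where b0: "\<And>n. h n < b0 n" "minLLc h = bLLc (\<lambda>n. enat (b0 n)) h"
    using minLLc_attained by blast
  have ge1: "1 \<le> b n" if "\<And>n. h n < b n" for b :: "nat \<Rightarrow> nat" and n
    using that[of n] by simp
  have min_ge: "bLLc (\<lambda>_. \<infinity>) h \<le> minLLc h"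
    unfolding b0(2) bLLc_bnum
    by (rule tukey_bnum[OF card_Baire_le card_Baire_le tukey_bounded_unbounded_localization
          unbounded_seqs]) (simp add: b0(1))
  have e_le: "evasion_number \<le> minLLc h"
    unfolding b0(2) bLLc_bnum evasion_bnum
    by (rule tukey_bnum[OF card_Baire_le card_Baire_le
          tukey_localization_prediction[OF h assms(2) ge1[OF b0(1)]] unbounded_seqs])
      (simp add: b0(1))
  have sup_le: "supLLc h \<le> dLLc (\<lambda>_. \<infinity>) h"
    unfolding dLLc_dnum[of "\<lambda>_. \<infinity>"]
    by (rule supLLc_least, unfold dLLc_dnum)
      (rule tukey_dnum[OF card_pairs_slalom_le card_pairs_slalom_le
          tukey_bounded_unbounded_localization dominating_slaloms[OF h]])
  have pr_ge: "supLLc h \<le> prediction_number"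
    unfolding prediction_dnum
    by (rule supLLc_least, unfold dLLc_dnum)
      (rule tukey_dnum[OF card_pairs_slalom_le card_pairs_predictor_le
          tukey_localization_prediction[OF h assms(2) ge1] dominating_predictors])
  have B: "bLLc (\<lambda>_. \<infinity>) h = min unbounding_number (minLLc h)"
    using min_unbounding_minLLc_le b_le min_ge by (intro antisym) auto
  have D: "dLLc (\<lambda>_. \<infinity>) h = max dominating_number (supLLc h)"
    using dLLc_le_max_dominating_supLLc[OF h] d_le sup_le by (intro antisym) auto
  \<comment> \<open>Sandwich: \<open>bLLc\<close> lies below the left minimum, which lies below the
    right one since \<open>evasion_number \<le> minLLc h\<close>, and the right one equals
    \<open>bLLc\<close>. The remaining identity is dual.\<close>
  have "min unbounding_number evasion_number = min unbounding_number (minLLc h)"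
    using e_ge e_le B by (intro antisym) (auto simp: min_le_iff_disj)
  moreover have "max dominating_number prediction_number = max dominating_number (supLLc h)"
    using pr_le pr_ge D by (intro antisym) (auto simp: le_max_iff_disj)
  ultimately show ?thesis using B D by blast
qed

end
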